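(* Let $R$ be a $\mathbb{C}$-algebra which is a noetherian UFD, and for $a,b\in R$ put $A_{a,b}:=R[U,V]/(aU-bV-1)$. Let $r,s,r',s'\in R$ and suppose that each of the pairs $(a,b)=(r,s)$ and $(a,b)=(r',s')$ satisfies: the ideal $(a,b)$ has height $2$; $a,b$ share no common non-unit factor; $A_{a,b}$ is a UFD; $A_{a,b}^*=R^*$; $R$ is rigid and $ML(A_{a,b})=R$; and the restriction map $\operatorname{Aut}_{\mathbb{C}}(A_{a,b})\to\operatorname{Aut}_{\mathbb{C}}(R)$, $\sigma\mapsto\sigma|_R$ (well defined since such $\sigma$ satisfy $\sigma(R)=R$), is surjective. If $A_{r,s}\cong A_{r',s'}$ as $\mathbb{C}$-algebras, then there exists $\varphi\in\operatorname{Aut}_{\mathbb{C}}(R)$ such that $\varphi(r)R+\varphi(s)R=r'R+s'R$.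
   Context: A derivation $D$ of a ring $B$ is locally nilpotent if for every $b\in B$ there is $n$ with $D^n(b)=0$; $\operatorname{LND}(B)$ denotes the set of locally nilpotent $\mathbb{C}$-derivations of the $\mathbb{C}$-algebra $B$. The Makar-Limanov invariant $ML(B)$ is the intersection of the kernels of all $D\in\operatorname{LND}(B)$. $B$ is rigid if $\operatorname{LND}(B)=\{0\}$. $B^*$ denotes the unit group. *)

theory Defs
  imports "HOL-Algebra.Algebra" "HOL-Library.Extended_Nat"
begin

definition CC :: "complex ring" where
  "CC = \<lparr>carrier = UNIV, monoid.mult = (*), one = 1, ring.zero = 0, add = (+)\<rparr>"

text \<open>A C-algebra is a commutative ring A together with a ring homomorphism
  iA from CC to A (its structure map). Scalar multiplication by c is
  multiplication by iA c.\<close>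

definition is_C_algebra :: "('a, 'm) ring_scheme \<Rightarrow> (complex \<Rightarrow> 'a) \<Rightarrow> bool" where
  "is_C_algebra A iA \<longleftrightarrow> cring A \<and> iA \<in> ring_hom CC A"

definition C_alg_hom ::
  "('a, 'm) ring_scheme \<Rightarrow> (complex \<Rightarrow> 'a) \<Rightarrow> ('b, 'n) ring_scheme \<Rightarrow> (complex \<Rightarrow> 'b)
    \<Rightarrow> ('a \<Rightarrow> 'b) \<Rightarrow> bool" where
  "C_alg_hom A iA B iB f \<longleftrightarrow> f \<in> ring_hom A B \<and> (\<forall>c. f (iA c) = iB c)"

definition C_alg_iso ::
  "('a, 'm) ring_scheme \<Rightarrow> (complex \<Rightarrow> 'a) \<Rightarrow> ('b, 'n) ring_scheme \<Rightarrow> (complex \<Rightarrow> 'b)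
    \<Rightarrow> ('a \<Rightarrow> 'b) \<Rightarrow> bool" where
  "C_alg_iso A iA B iB f \<longleftrightarrow> C_alg_hom A iA B iB f \<and> bij_betw f (carrier A) (carrier B)"

definition C_alg_aut :: "('a, 'm) ring_scheme \<Rightarrow> (complex \<Rightarrow> 'a) \<Rightarrow> ('a \<Rightarrow> 'a) set" where
  "C_alg_aut A iA = {f. C_alg_iso A iA A iA f}"

definition C_derivation :: "('a, 'm) ring_scheme \<Rightarrow> (complex \<Rightarrow> 'a) \<Rightarrow> ('a \<Rightarrow> 'a) \<Rightarrow> bool" where
  "C_derivation A iA D \<longleftrightarrow>
     D \<in> carrier A \<rightarrow> carrier A \<and>
     (\<forall>x\<in>carrier A. \<forall>y\<in>carrier A. D (x \<oplus>\<^bsub>A\<^esub> y) = D x \<oplus>\<^bsub>A\<^esub> D y) \<and>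
     (\<forall>c. \<forall>x\<in>carrier A. D (iA c \<otimes>\<^bsub>A\<^esub> x) = iA c \<otimes>\<^bsub>A\<^esub> D x) \<and>
     (\<forall>x\<in>carrier A. \<forall>y\<in>carrier A.
        D (x \<otimes>\<^bsub>A\<^esub> y) = (x \<otimes>\<^bsub>A\<^esub> D y) \<oplus>\<^bsub>A\<^esub> (y \<otimes>\<^bsub>A\<^esub> D x))"

definition LND :: "('a, 'm) ring_scheme \<Rightarrow> (complex \<Rightarrow> 'a) \<Rightarrow> ('a \<Rightarrow> 'a) set" where
  "LND A iA = {D. C_derivation A iA D \<and> (\<forall>b\<in>carrier A. \<exists>n. (D ^^ n) b = \<zero>\<^bsub>A\<^esub>)}"

definition makar_limanov :: "('a, 'm) ring_scheme \<Rightarrow> (complex \<Rightarrow> 'a) \<Rightarrow> 'a set" where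
  "makar_limanov A iA = {x \<in> carrier A. \<forall>D\<in>LND A iA. D x = \<zero>\<^bsub>A\<^esub>}"

definition rigid :: "('a, 'm) ring_scheme \<Rightarrow> (complex \<Rightarrow> 'a) \<Rightarrow> bool" where
  "rigid A iA \<longleftrightarrow> (\<forall>D\<in>LND A iA. \<forall>x\<in>carrier A. D x = \<zero>\<^bsub>A\<^esub>)"

definition prime_chain :: "('a, 'm) ring_scheme \<Rightarrow> 'a set list \<Rightarrow> bool" where
  "prime_chain R Ps \<longleftrightarrow> Ps \<noteq> [] \<and> (\<forall>P\<in>set Ps. primeideal P R) \<and> sorted_wrt (\<subset>) Ps"

definition prime_height :: "('a, 'm) ring_scheme \<Rightarrow> 'a set \<Rightarrow> enat" where
  "prime_height R P = (SUP Ps \<in> {Ps. prime_chain R Ps \<and> last Ps = P}. enat (length Ps - 1))"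

definition ideal_height :: "('a, 'm) ring_scheme \<Rightarrow> 'a set \<Rightarrow> enat" where
  "ideal_height R I = (INF P \<in> {P. primeideal P R \<and> I \<subseteq> P}. prime_height R P)"

text \<open>R[U,V] is realized as (R[U])[V]; U is the variable of the inner
  polynomial ring, V that of the outer one.\<close>

definition polyUV :: "('a, 'm) ring_scheme \<Rightarrow> (nat \<Rightarrow> 'a, nat \<Rightarrow> nat \<Rightarrow> 'a) up_ring" where
  "polyUV R = UP (UP R)"

definition constUV :: "('a, 'm) ring_scheme \<Rightarrow> 'a \<Rightarrow> nat \<Rightarrow> nat \<Rightarrow> 'a" where
  "constUV R x = monom (polyUV R) (monom (UP R) x 0) 0"

definition varU :: "('a, 'm) ring_scheme \<Rightarrow> nat \<Rightarrow> nat \<Rightarrow> 'a" where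
  "varU R = monom (polyUV R) (monom (UP R) \<one>\<^bsub>R\<^esub> 1) 0"

definition varV :: "('a, 'm) ring_scheme \<Rightarrow> nat \<Rightarrow> nat \<Rightarrow> 'a" where
  "varV R = monom (polyUV R) \<one>\<^bsub>UP R\<^esub> 1"

definition rel_ideal :: "('a, 'm) ring_scheme \<Rightarrow> 'a \<Rightarrow> 'a \<Rightarrow> (nat \<Rightarrow> nat \<Rightarrow> 'a) set" where
  "rel_ideal R a b = Idl\<^bsub>polyUV R\<^esub>
     {(constUV R a \<otimes>\<^bsub>polyUV R\<^esub> varU R) \<ominus>\<^bsub>polyUV R\<^esub> (constUV R b \<otimes>\<^bsub>polyUV R\<^esub> varV R)
        \<ominus>\<^bsub>polyUV R\<^esub> \<one>\<^bsub>polyUV R\<^esub>}"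

definition Aab :: "('a, 'm) ring_scheme \<Rightarrow> 'a \<Rightarrow> 'a \<Rightarrow> (nat \<Rightarrow> nat \<Rightarrow> 'a) set ring" where
  "Aab R a b = polyUV R Quot rel_ideal R a b"

definition canA :: "('a, 'm) ring_scheme \<Rightarrow> 'a \<Rightarrow> 'a \<Rightarrow> 'a \<Rightarrow> (nat \<Rightarrow> nat \<Rightarrow> 'a) set" where
  "canA R a b x = rel_ideal R a b +>\<^bsub>polyUV R\<^esub> constUV R x"

definition iAab :: "('a, 'm) ring_scheme \<Rightarrow> (complex \<Rightarrow> 'a) \<Rightarrow> 'a \<Rightarrow> 'a \<Rightarrow> complex \<Rightarrow> (nat \<Rightarrow> nat \<Rightarrow> 'a) set" where
  "iAab R iR a b c = canA R a b (iR c)"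

definition good_pair :: "('a, 'm) ring_scheme \<Rightarrow> (complex \<Rightarrow> 'a) \<Rightarrow> 'a \<Rightarrow> 'a \<Rightarrow> bool" where
  "good_pair R iR a b \<longleftrightarrow>
     a \<in> carrier R \<and> b \<in> carrier R \<and>
     ideal_height R (Idl\<^bsub>R\<^esub> {a, b}) = 2 \<and>
     (\<forall>c\<in>carrier R. c divides\<^bsub>R\<^esub> a \<and> c divides\<^bsub>R\<^esub> b \<longrightarrow> c \<in> Units R) \<and>
     factorial_domain (Aab R a b) \<and>
     Units (Aab R a b) = canA R a b ` Units R \<and>
     rigid R iR \<and>
     makar_limanov (Aab R a b) (iAab R iR a b) = canA R a b ` carrier R \<and>
     (\<forall>\<phi>\<in>C_alg_aut R iR. \<exists>\<sigma>\<in>C_alg_aut (Aab R a b) (iAab R iR a b).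
        \<forall>x\<in>carrier R. \<sigma> (canA R a b x) = canA R a b (\<phi> x))"

end

theory Submission
  imports Defs
begin

text \<open>
  Write \<open>A = R[U,V]/(aU - bV - 1)\<close>. A locally nilpotent derivation \<open>E\<close> of \<open>A\<close> kills
  \<open>ML(A) = R\<close>, so \<open>a E(U) = b E(V)\<close>, and \<open>aU - bV = 1\<close> gives \<open>E(U) = b g\<close> and \<open>E(V) = a g\<close> with
  \<open>g = U E(V) - V E(U)\<close>. Hence any two such derivations are proportional, so the kernel of a nonzero
  one is \<open>ML(A) = R\<close>, and \<open>g\<close> generates the ideal spanned by \<open>E(A)\<close>. If \<open>E(x) = g c\<close> with \<open>c\<close> in
  \<open>R\<close>, then \<open>ax - cV\<close> and \<open>bx - cU\<close> lie in the kernel of \<open>E\<close>, that is, in \<open>R\<close>, and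
  \<open>b(ax - cV) - a(bx - cU) = c\<close>. So \<open>(a,b)\<close> consists of the \<open>c\<close> in \<open>R\<close> with \<open>g c\<close> in \<open>E(A)\<close>.
  An isomorphism of two such algebras preserves the Makar-Limanov invariant, hence restricts to an
  automorphism of \<open>R\<close>; it transports \<open>E\<close>, and it transports \<open>g\<close> up to a unit, which lies in \<open>R\<close>.
  It therefore carries one ideal to the other.
\<close>

section \<open>Ideals with two generators\<close>

lemma (in cring) genideal_pair:
  assumes "a \<in> carrier R" "b \<in> carrier R"
  shows "Idl {a, b} = {x \<otimes> a \<oplus> y \<otimes> b | x y. x \<in> carrier R \<and> y \<in> carrier R}"
    (is "_ = ?S")
proof
  have "ideal ?S R"
  proof (rule idealI[OF ring_axioms])
    show "subgroup ?S (add_monoid R)"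
    proof (rule add.subgroupI)
      show "?S \<subseteq> carrier R" using assms by auto
      show "?S \<noteq> {}" by blast
    next
      fix u assume "u \<in> ?S"
      then obtain x y where "x \<in> carrier R" "y \<in> carrier R" "u = x \<otimes> a \<oplus> y \<otimes> b" by blast
      then have "\<ominus> u = (\<ominus> x) \<otimes> a \<oplus> (\<ominus> y) \<otimes> b" "\<ominus> x \<in> carrier R" "\<ominus> y \<in> carrier R"
        using assms by (simp_all, algebra)
      then show "\<ominus> u \<in> ?S" by blast
    next
      fix u v assume "u \<in> ?S" "v \<in> ?S"
      then obtain x y x' y' where
        c: "x \<in> carrier R" "y \<in> carrier R" "x' \<in> carrier R" "y' \<in> carrier R" and
        e: "u = x \<otimes> a \<oplus> y \<otimes> b" "v = x' \<otimes> a \<oplus> y' \<otimes> b" by blast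
      then have "u \<oplus> v = (x \<oplus> x') \<otimes> a \<oplus> (y \<oplus> y') \<otimes> b"
        using assms by algebra
      moreover have "x \<oplus> x' \<in> carrier R" "y \<oplus> y' \<in> carrier R" using c by auto
      ultimately show "u \<oplus> v \<in> ?S" by blast
    qed
  next
    fix u z assume "u \<in> ?S" and z: "z \<in> carrier R"
    then obtain x y where
      c: "x \<in> carrier R" "y \<in> carrier R" and e: "u = x \<otimes> a \<oplus> y \<otimes> b" by blast
    then have "z \<otimes> u = (z \<otimes> x) \<otimes> a \<oplus> (z \<otimes> y) \<otimes> b" "u \<otimes> z = (z \<otimes> x) \<otimes> a \<oplus> (z \<otimes> y) \<otimes> b"
      using assms z by algebra+
    moreover have "z \<otimes> x \<in> carrier R" "z \<otimes> y \<in> carrier R" using c z by auto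
    ultimately show "z \<otimes> u \<in> ?S" "u \<otimes> z \<in> ?S" by blast+
  qed
  moreover have "a = \<one> \<otimes> a \<oplus> \<zero> \<otimes> b" "b = \<zero> \<otimes> a \<oplus> \<one> \<otimes> b" using assms by simp_all
  then have "{a, b} \<subseteq> ?S" by blast
  ultimately show "Idl {a, b} \<subseteq> ?S" by (rule genideal_minimal)
next
  interpret I: ideal "Idl {a, b}" R by (rule genideal_ideal) (use assms in auto)
  have "a \<in> Idl {a, b}" "b \<in> Idl {a, b}" using genideal_self[of "{a, b}"] assms by auto
  then show "?S \<subseteq> Idl {a, b}" by (auto intro!: I.a_closed I.I_l_closed)
qed

section \<open>Derivations and their transport along isomorphisms of C-algebras\<close>

lemma C_derivationD:
  assumes "C_derivation A iA D"
  shows "x \<in> carrier A \<Longrightarrow> D x \<in> carrier A"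
    and "x \<in> carrier A \<Longrightarrow> y \<in> carrier A \<Longrightarrow> D (x \<oplus>\<^bsub>A\<^esub> y) = D x \<oplus>\<^bsub>A\<^esub> D y"
    and "x \<in> carrier A \<Longrightarrow> y \<in> carrier A \<Longrightarrow>
      D (x \<otimes>\<^bsub>A\<^esub> y) = (x \<otimes>\<^bsub>A\<^esub> D y) \<oplus>\<^bsub>A\<^esub> (y \<otimes>\<^bsub>A\<^esub> D x)"
    and "x \<in> carrier A \<Longrightarrow> D (iA c \<otimes>\<^bsub>A\<^esub> x) = iA c \<otimes>\<^bsub>A\<^esub> D x"
  using assms unfolding C_derivation_def by auto

lemma LND_derivation: "D \<in> LND A iA \<Longrightarrow> C_derivation A iA D"
  by (simp add: LND_def)

lemma (in ring) C_derivation_minus: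
  assumes D: "C_derivation R iA D" and "x \<in> carrier R" "y \<in> carrier R"
  shows "D (x \<ominus> y) = D x \<ominus> D y"
proof -
  have "D ((x \<ominus> y) \<oplus> y) = D (x \<ominus> y) \<oplus> D y" by (intro C_derivationD[OF D]) (use assms in auto)
  moreover have "(x \<ominus> y) \<oplus> y = x" using assms(2,3) by algebra
  moreover have "D x \<in> carrier R" "D y \<in> carrier R" "D (x \<ominus> y) \<in> carrier R"
    using C_derivationD(1)[OF D] assms by auto
  ultimately show ?thesis by algebra
qed

lemma C_alg_iso_sym:
  assumes "C_alg_iso A iA B iB f" "cring A" "cring B" "\<And>c. iA c \<in> carrier A"
  shows "C_alg_iso B iB A iA (inv_into (carrier A) f)"
proof -
  have f: "f \<in> ring_hom A B" "bij_betw f (carrier A) (carrier B)" "\<And>c. f (iA c) = iB c"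
    using assms by (auto simp: C_alg_iso_def C_alg_hom_def)
  have "inv_into (carrier A) f \<in> ring_hom B A"
    using ring_iso_set_sym[OF cring.axioms(1)[OF assms(2)], of f B] f
    by (simp add: ring_iso_def)
  moreover have "inv_into (carrier A) f (iB c) = iA c" for c
    using f assms(4) by (metis bij_betw_imp_inj_on inv_into_f_f)
  ultimately show ?thesis
    using f bij_betw_inv_into by (auto simp: C_alg_iso_def C_alg_hom_def)
qed

text \<open>Since \<open>h\<close> is inverse to \<open>f\<close>, the inner factors cancel in every
  iterate of the conjugate. Nilpotency at \<open>y\<close> is therefore inherited from nilpotency of
  \<open>D\<close> at \<open>h y\<close>.\<close>

lemma LND_conjugate:
  assumes f: "C_alg_iso A iA B iB f" and h: "C_alg_iso B iB A iA h"
    and fh: "\<And>y. y \<in> carrier B \<Longrightarrow> f (h y) = y" and hf: "\<And>x. x \<in> carrier A \<Longrightarrow> h (f x) = x"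
    and A: "cring A" "cring B" "\<And>c. iA c \<in> carrier A" and D: "D \<in> LND A iA"
  shows "(\<lambda>y. f (D (h y))) \<in> LND B iB"
proof -
  have fr: "f \<in> ring_hom A B" "\<And>c. f (iA c) = iB c" and hr: "h \<in> ring_hom B A" "\<And>c. h (iB c) = iA c"
    using f h by (auto simp: C_alg_iso_def C_alg_hom_def)
  have iB: "iB c \<in> carrier B" for c using fr A(3) by (metis ring_hom_closed)
  note d = C_derivationD(1-3)[OF LND_derivation[OF D]]
    and dC = C_derivationD(4)[OF LND_derivation[OF D]]
  interpret A: cring A by fact
  note [simp] = ring_hom_closed[OF fr(1)] ring_hom_closed[OF hr(1)] d
    ring_hom_add[OF fr(1)] ring_hom_add[OF hr(1)] ring_hom_mult[OF fr(1)] ring_hom_mult[OF hr(1)]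
    fr(2) hr(2) fh hf iB A(3)
  have "C_derivation B iB (\<lambda>y. f (D (h y)))"
    unfolding C_derivation_def
  proof (intro conjI allI ballI)
    fix c x assume "x \<in> carrier B"
    then show "f (D (h (iB c \<otimes>\<^bsub>B\<^esub> x))) = iB c \<otimes>\<^bsub>B\<^esub> f (D (h x))"
      using dC[of "h x" c] by (simp del: d(3))
  qed auto
  moreover have "\<exists>n. ((\<lambda>y. f (D (h y))) ^^ n) y = \<zero>\<^bsub>B\<^esub>" if y: "y \<in> carrier B" for y
  proof -
    \<comment> \<open>Membership in the carrier is carried through the induction because
      \<open>h\<close> cancels \<open>f\<close> only there.\<close>
    have "((\<lambda>y. f (D (h y))) ^^ n) y = f ((D ^^ n) (h y)) \<and> (D ^^ n) (h y) \<in> carrier A" for n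
      using y by (induction n) auto
    moreover obtain n where "(D ^^ n) (h y) = \<zero>\<^bsub>A\<^esub>"
      using D ring_hom_closed[OF hr(1) y] unfolding LND_def by blast
    ultimately show ?thesis
      using ring_hom_zero[OF fr(1)] A by (metis cring.axioms(1))
  qed
  ultimately show ?thesis by (auto simp: LND_def)
qed

text \<open>A locally nilpotent \<open>D\<close> on \<open>B\<close> is pulled back to
  \<open>A\<close> by conjugation with the roles of \<open>f\<close> and \<open>h\<close> exchanged.
  The pullback kills \<open>x\<close>, which says that \<open>h (D (f x))\<close> is zero, and
  applying \<open>f\<close> gives the claim.\<close>

lemma makar_limanov_iso:
  assumes f: "C_alg_iso A iA B iB f" and A: "cring A" "cring B" "\<And>c. iA c \<in> carrier A"
    and x: "x \<in> makar_limanov A iA"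
  shows "f x \<in> makar_limanov B iB"
proof -
  define h where "h = inv_into (carrier A) f"
  have h: "C_alg_iso B iB A iA h" unfolding h_def by (rule C_alg_iso_sym[OF f A])
  have fr: "f \<in> ring_hom A B" "\<And>c. f (iA c) = iB c" and hr: "h \<in> ring_hom B A"
    and bij: "bij_betw f (carrier A) (carrier B)"
    using f h by (auto simp: C_alg_iso_def C_alg_hom_def)
  have fh: "\<And>y. y \<in> carrier B \<Longrightarrow> f (h y) = y" and hf: "\<And>x. x \<in> carrier A \<Longrightarrow> h (f x) = x"
    unfolding h_def using bij
    by (auto simp: bij_betw_inv_into_right bij_betw_inv_into_left)
  have iB: "iB c \<in> carrier B" for c using fr A(3) by (metis ring_hom_closed)
  have xA: "x \<in> carrier A" using x by (simp add: makar_limanov_def)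
  have "D (f x) = \<zero>\<^bsub>B\<^esub>" if D: "D \<in> LND B iB" for D
  proof -
    have "h (D (f x)) = \<zero>\<^bsub>A\<^esub>"
      using LND_conjugate[OF h f hf fh A(2,1) iB D] x by (auto simp: makar_limanov_def)
    moreover have "D (f x) \<in> carrier B"
      using C_derivationD(1)[OF LND_derivation[OF D]] ring_hom_closed[OF fr(1) xA] by simp
    ultimately show ?thesis using fh ring_hom_zero[OF fr(1)] A
      by (metis cring.axioms(1))
  qed
  then show ?thesis using ring_hom_closed[OF fr(1) xA] by (simp add: makar_limanov_def)
qed

section \<open>Locally nilpotent derivations of an extension with a unimodular relation\<close>

text \<open>This abstracts from the quotient what the derivation argument uses, so that it can be
  instantiated at both algebras of the theorem. The assumption \<open>gen\<close> says that
  \<open>A\<close> is generated as a ring by the image of \<open>R\<close> together with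
  \<open>U\<close> and \<open>V\<close>, in the form of an induction principle; negatives arise as
  products with the constant minus one.\<close>

locale unimodular_extension =
  A?: domain A + R: cring R
  for A (structure) and iA :: "complex \<Rightarrow> _" and R and i and a b U V +
  assumes hom: "i \<in> ring_hom R A"
    and inj: "inj_on i (carrier R)"
    and ab: "a \<in> carrier R" "b \<in> carrier R"
    and UV: "U \<in> carrier A" "V \<in> carrier A"
    and unimod: "i a \<otimes> U = i b \<otimes> V \<oplus> \<one>"
    and gen: "\<And>S x. \<lbrakk>i ` carrier R \<subseteq> S; U \<in> S; V \<in> S;
        \<And>x y. \<lbrakk>x \<in> carrier A; y \<in> carrier A; x \<in> S; y \<in> S\<rbrakk> \<Longrightarrow> x \<oplus> y \<in> S;
        \<And>x y. \<lbrakk>x \<in> carrier A; y \<in> carrier A; x \<in> S; y \<in> S\<rbrakk> \<Longrightarrow> x \<otimes> y \<in> S;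
        x \<in> carrier A\<rbrakk> \<Longrightarrow> x \<in> S"
    and ml_base: "makar_limanov A iA = i ` carrier R"
begin

text \<open>The element \<open>g\<close> of the introduction: the Wronskian of the pair
  \<open>U\<close>, \<open>V\<close> with respect to \<open>E\<close>.\<close>

definition wronskian where "wronskian E = U \<otimes> E V \<ominus> V \<otimes> E U"

lemma i_closed [simp]: "x \<in> carrier R \<Longrightarrow> i x \<in> carrier A"
  by (rule ring_hom_closed[OF hom])

lemma LND_closed [simp]: "E \<in> LND A iA \<Longrightarrow> x \<in> carrier A \<Longrightarrow> E x \<in> carrier A"
  by (rule C_derivationD(1)[OF LND_derivation])

lemma LND_base [simp]: "E \<in> LND A iA \<Longrightarrow> x \<in> carrier R \<Longrightarrow> E (i x) = \<zero>"
  using ml_base unfolding makar_limanov_def by blast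

lemma LND_linear:
  "E \<in> LND A iA \<Longrightarrow> x \<in> carrier R \<Longrightarrow> y \<in> carrier A \<Longrightarrow> E (i x \<otimes> y) = i x \<otimes> E y"
  using C_derivationD(3)[OF LND_derivation, of E A iA "i x" y] by simp

lemma wronskian_closed [simp]: "E \<in> LND A iA \<Longrightarrow> wronskian E \<in> carrier A"
  using UV by (simp add: wronskian_def)

lemma LND_U_V:
  assumes E: "E \<in> LND A iA"
  shows "E U = i b \<otimes> wronskian E" "E V = i a \<otimes> wronskian E"
proof -
  have "E \<one> = \<zero>" using LND_base[OF E R.one_closed] ring_hom_one[OF hom] by simp
  then have "i a \<otimes> E U = i b \<otimes> E V"
    using arg_cong[OF unimod, of E] UV ab E
    by (simp add: LND_linear C_derivationD(2)[OF LND_derivation[OF E]])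
  moreover have c: "i a \<in> carrier A" "i b \<in> carrier A" "E U \<in> carrier A" "E V \<in> carrier A"
    using ab E UV by auto
  ultimately have e: "i a \<otimes> E U = i b \<otimes> E V" by simp
  \<comment> \<open>In \<open>b g\<close> the factor \<open>b E(V)\<close> is exchanged for
    \<open>a E(U)\<close>. Then \<open>E(U)\<close> is left with the coefficient
    \<open>aU - bV\<close>, which is 1. The computation of \<open>a g\<close> below is
    symmetric.\<close>
  have "i b \<otimes> wronskian E = U \<otimes> (i b \<otimes> E V) \<ominus> (i b \<otimes> V) \<otimes> E U"
    unfolding wronskian_def using c UV by algebra
  also have "\<dots> = (i a \<otimes> U) \<otimes> E U \<ominus> (i b \<otimes> V) \<otimes> E U"
    unfolding e[symmetric] using c UV by algebra
  also have "\<dots> = E U" unfolding unimod using c UV by algebra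
  finally show "E U = i b \<otimes> wronskian E" ..
  have "i a \<otimes> wronskian E = (i a \<otimes> U) \<otimes> E V \<ominus> V \<otimes> (i a \<otimes> E U)"
    unfolding wronskian_def using c UV by algebra
  also have "\<dots> = E V"
    unfolding e unimod using c UV by algebra
  finally show "E V = i a \<otimes> wronskian E" ..
qed

text \<open>Both sides vanish on \<open>R\<close>. They agree on \<open>U\<close> and
  \<open>V\<close> because the values of \<open>E\<close> and \<open>F\<close> there are the same
  multiples of the respective Wronskians. By additivity and the Leibniz rule the set of agreement is
  closed under sums and products, so \<open>gen\<close> applies.\<close>

lemma LND_proportional:
  assumes E: "E \<in> LND A iA" and F: "F \<in> LND A iA" and x: "x \<in> carrier A"
  shows "wronskian E \<otimes> F x = wronskian F \<otimes> E x"
proof -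
  let ?S = "{x. wronskian E \<otimes> F x = wronskian F \<otimes> E x}"
  note e = C_derivationD[OF LND_derivation[OF E]] and f = C_derivationD[OF LND_derivation[OF F]]
  have c: "wronskian E \<in> carrier A" "wronskian F \<in> carrier A" using E F by auto
  have "x \<in> ?S"
  proof (rule gen[OF _ _ _ _ _ x])
    show "i ` carrier R \<subseteq> ?S" using E F by auto
    have "i a \<in> carrier A" "i b \<in> carrier A" using ab by auto
    with c show "U \<in> ?S" "V \<in> ?S" unfolding mem_Collect_eq LND_U_V[OF E] LND_U_V[OF F] by algebra+
  next
    fix x y assume *: "x \<in> carrier A" "y \<in> carrier A" "x \<in> ?S" "y \<in> ?S"
    then show "x \<oplus> y \<in> ?S" using c e(1) f(1) by (simp add: e(2) f(2) r_distr)
    have d: "E x \<in> carrier A" "E y \<in> carrier A" "F x \<in> carrier A" "F y \<in> carrier A"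
      using * e(1) f(1) by auto
    have "wronskian E \<otimes> F (x \<otimes> y) = x \<otimes> (wronskian E \<otimes> F y) \<oplus> y \<otimes> (wronskian E \<otimes> F x)"
      unfolding f(3)[OF *(1,2)] using c d *(1,2) by algebra
    also have "\<dots> = x \<otimes> (wronskian F \<otimes> E y) \<oplus> y \<otimes> (wronskian F \<otimes> E x)" using * by simp
    also have "\<dots> = wronskian F \<otimes> E (x \<otimes> y)"
      unfolding e(3)[OF *(1,2)] using c d *(1,2) by algebra
    finally show "x \<otimes> y \<in> ?S" by simp
  qed
  then show ?thesis by simp
qed

text \<open>It suffices to check divisibility on generators, since the Leibniz rule preserves it.
  The Wronskian itself being a combination of \<open>E U\<close> and \<open>E V\<close>, it
  generates the ideal spanned by the values of \<open>E\<close>; this intrinsic description makes it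
  comparable across an isomorphism.\<close>

lemma wronskian_dvd:
  assumes E: "E \<in> LND A iA" and x: "x \<in> carrier A"
  shows "\<exists>k\<in>carrier A. E x = wronskian E \<otimes> k"
proof -
  let ?S = "{x. \<exists>k\<in>carrier A. E x = wronskian E \<otimes> k}"
  note e = C_derivationD[OF LND_derivation[OF E]]
  have c: "wronskian E \<in> carrier A" using E by auto
  have "x \<in> ?S"
  proof (rule gen[OF _ _ _ _ _ x])
    show "i ` carrier R \<subseteq> ?S" using E c by (auto intro!: bexI[of _ \<zero>])
    have "i a \<in> carrier A" "i b \<in> carrier A" using ab by auto
    with c show "U \<in> ?S" "V \<in> ?S" unfolding mem_Collect_eq LND_U_V[OF E]
      using m_comm by blast+
  next
    fix x y assume *: "x \<in> carrier A" "y \<in> carrier A" and "x \<in> ?S" "y \<in> ?S"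
    then obtain k l where k: "k \<in> carrier A" "l \<in> carrier A"
      "E x = wronskian E \<otimes> k" "E y = wronskian E \<otimes> l" by auto
    have "E (x \<oplus> y) = wronskian E \<otimes> (k \<oplus> l)" unfolding e(2)[OF *] using k c by algebra
    then show "x \<oplus> y \<in> ?S" using k by blast
    have "E (x \<otimes> y) = wronskian E \<otimes> (x \<otimes> l \<oplus> y \<otimes> k)"
      unfolding e(3)[OF *] using k c * by algebra
    then show "x \<otimes> y \<in> ?S" using k * by blast
  qed
  then show ?thesis by simp
qed

text \<open>Proportionality and the absence of zero divisors make every other \<open>F\<close> in
  \<open>LND A iA\<close> vanish at \<open>x\<close> as well, so \<open>x\<close> lies in the
  Makar-Limanov invariant.\<close>

lemma ker_LND:
  assumes E: "E \<in> LND A iA" and g: "wronskian E \<noteq> \<zero>" and x: "x \<in> carrier A" "E x = \<zero>"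
  shows "x \<in> i ` carrier R"
proof -
  have "F x = \<zero>" if F: "F \<in> LND A iA" for F
    using LND_proportional[OF E F x(1)] x E F g by (simp add: integral_iff)
  then show ?thesis using x(1) by (simp add: ml_base[symmetric] makar_limanov_def)
qed

text \<open>The ideal is the plinth ideal of the derivation \<open>E / wronskian E\<close>.\<close>
lemma mem_ideal_iff_LND:
  assumes E: "E \<in> LND A iA" and g: "wronskian E \<noteq> \<zero>" and c: "c \<in> carrier R"
  shows "c \<in> Idl\<^bsub>R\<^esub> {a, b} \<longleftrightarrow> (\<exists>x\<in>carrier A. E x = wronskian E \<otimes> i c)"
proof
  have w: "wronskian E \<in> carrier A" "i a \<in> carrier A" "i b \<in> carrier A" using E ab by auto
  assume "c \<in> Idl\<^bsub>R\<^esub> {a, b}"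
  then obtain x y where xy: "x \<in> carrier R" "y \<in> carrier R" "c = x \<otimes>\<^bsub>R\<^esub> a \<oplus>\<^bsub>R\<^esub> y \<otimes>\<^bsub>R\<^esub> b"
    using R.genideal_pair[OF ab] by auto
  have ic: "i c = i x \<otimes> i a \<oplus> i y \<otimes> i b"
    using xy ab by (simp add: ring_hom_add[OF hom] ring_hom_mult[OF hom])
  have xyA: "i x \<in> carrier A" "i y \<in> carrier A" using xy by auto
  \<comment> \<open>The witness pairs the coefficient of \<open>a\<close> with \<open>V\<close> and
    that of \<open>b\<close> with \<open>U\<close>, because \<open>E V\<close> is \<open>a g\<close>
    and \<open>E U\<close> is \<open>b g\<close>.\<close>
  have "E (i x \<otimes> V \<oplus> i y \<otimes> U) = i x \<otimes> E V \<oplus> i y \<otimes> E U"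
    using xy UV E xyA by (simp add: C_derivationD(2)[OF LND_derivation[OF E]] LND_linear)
  also have "\<dots> = wronskian E \<otimes> i c"
    unfolding LND_U_V[OF E] ic using w xyA by algebra
  finally show "\<exists>x\<in>carrier A. E x = wronskian E \<otimes> i c" using xyA UV by blast
next
  have w: "wronskian E \<in> carrier A" "i a \<in> carrier A" "i b \<in> carrier A" "i c \<in> carrier A"
    using E ab c by auto
  assume "\<exists>x\<in>carrier A. E x = wronskian E \<otimes> i c"
  then obtain x where x: "x \<in> carrier A" "E x = wronskian E \<otimes> i c" by blast
  note s = C_derivation_minus[OF LND_derivation[OF E]]
  have "E (i a \<otimes> x \<ominus> i c \<otimes> V) = i a \<otimes> E x \<ominus> i c \<otimes> E V"
    using s[of "i a \<otimes> x" "i c \<otimes> V"] x(1) w UV ab c E by (simp add: LND_linear)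
  also have "\<dots> = \<zero>" unfolding LND_U_V[OF E] x(2) using w by algebra
  finally obtain y where y: "y \<in> carrier R" "i a \<otimes> x \<ominus> i c \<otimes> V = i y"
    using ker_LND[OF E g, of "i a \<otimes> x \<ominus> i c \<otimes> V"] x(1) w UV by auto
  have "E (i b \<otimes> x \<ominus> i c \<otimes> U) = i b \<otimes> E x \<ominus> i c \<otimes> E U"
    using s[of "i b \<otimes> x" "i c \<otimes> U"] x(1) w UV ab c E by (simp add: LND_linear)
  also have "\<dots> = \<zero>" unfolding LND_U_V[OF E] x(2) using w by algebra
  finally obtain z where z: "z \<in> carrier R" "i b \<otimes> x \<ominus> i c \<otimes> U = i z"
    using ker_LND[OF E g, of "i b \<otimes> x \<ominus> i c \<otimes> U"] x(1) w UV by auto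
  have yz: "i y \<in> carrier A" "i z \<in> carrier A" using y z by auto
  have "i y \<otimes> i b \<oplus> \<ominus> (i z \<otimes> i a) = i c \<otimes> (i a \<otimes> U \<ominus> i b \<otimes> V)"
    unfolding y(2)[symmetric] z(2)[symmetric] using w x(1) UV by algebra
  also have "\<dots> = i c" unfolding unimod using w UV by algebra
  finally have "i (y \<otimes>\<^bsub>R\<^esub> b \<oplus>\<^bsub>R\<^esub> (\<ominus>\<^bsub>R\<^esub> z) \<otimes>\<^bsub>R\<^esub> a) = i c"
    using y z ab yz w
      ring_hom_cring.hom_a_inv[OF ring_hom_cringI[OF
          R.cring_axioms cring_axioms hom], of z]
    by (simp add: ring_hom_add[OF hom] ring_hom_mult[OF hom] l_minus)
  then have "c = (\<ominus>\<^bsub>R\<^esub> z) \<otimes>\<^bsub>R\<^esub> a \<oplus>\<^bsub>R\<^esub> y \<otimes>\<^bsub>R\<^esub> b"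
    using inj_onD[OF inj, of "y \<otimes>\<^bsub>R\<^esub> b \<oplus>\<^bsub>R\<^esub> (\<ominus>\<^bsub>R\<^esub> z) \<otimes>\<^bsub>R\<^esub> a" c] y z ab c
    by (simp add: R.a_comm)
  then show "c \<in> Idl\<^bsub>R\<^esub> {a, b}"
    using R.genideal_pair[OF ab] y z by blast
qed

text \<open>If all Wronskians vanished, every locally nilpotent derivation would kill
  \<open>U\<close> and \<open>V\<close>. Both would then lie in the image of \<open>R\<close>, and
  the unimodular relation, pulled back to \<open>R\<close>, would express 1 through \<open>a\<close>
  and \<open>b\<close>.\<close>

lemma ex_LND_wronskian_nonzero:
  assumes "\<one>\<^bsub>R\<^esub> \<notin> Idl\<^bsub>R\<^esub> {a, b}"
  shows "\<exists>E\<in>LND A iA. wronskian E \<noteq> \<zero>"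
proof (rule ccontr)
  assume "\<not> ?thesis"
  then have "E U = \<zero>" "E V = \<zero>" if "E \<in> LND A iA" for E
    using LND_U_V[OF that] that ab by auto
  then have "U \<in> i ` carrier R" "V \<in> i ` carrier R"
    using UV by (auto simp: ml_base[symmetric] makar_limanov_def)
  then obtain u v where u: "u \<in> carrier R" "U = i u" and v: "v \<in> carrier R" "V = i v" by blast
  have "i (a \<otimes>\<^bsub>R\<^esub> u) = i (b \<otimes>\<^bsub>R\<^esub> v \<oplus>\<^bsub>R\<^esub> \<one>\<^bsub>R\<^esub>)"
    using unimod u v ab ring_hom_add[OF hom] ring_hom_mult[OF hom] ring_hom_one[OF hom] by simp
  then have "a \<otimes>\<^bsub>R\<^esub> u = b \<otimes>\<^bsub>R\<^esub> v \<oplus>\<^bsub>R\<^esub> \<one>\<^bsub>R\<^esub>"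
    using inj u v ab by (auto dest: inj_onD)
  then have "\<one>\<^bsub>R\<^esub> = u \<otimes>\<^bsub>R\<^esub> a \<oplus>\<^bsub>R\<^esub> (\<ominus>\<^bsub>R\<^esub> v) \<otimes>\<^bsub>R\<^esub> b"
    using u(1) v(1) ab R.one_closed by algebra
  then have "\<one>\<^bsub>R\<^esub> \<in> Idl\<^bsub>R\<^esub> {a, b}"
    using R.genideal_pair[OF ab] u v by blast
  with assms show False ..
qed

end

section \<open>The polynomial ring in two variables and its quotient\<close>

text \<open>A polynomial is the sum of its monomials, and each monomial is a constant times a power
  of the variable. The rule is applied once for \<open>U\<close> and once for \<open>V\<close>, and
  eventually yields \<open>gen\<close>.\<close>

lemma (in UP_cring) UP_subring_induct [consumes 1, case_names const var add mult]:
  assumes p: "p \<in> carrier P"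
    and const: "\<And>c. c \<in> carrier R \<Longrightarrow> Q (up_ring.monom P c 0)"
    and var: "Q (up_ring.monom P \<one> 1)"
    and add: "\<And>p q. \<lbrakk>p \<in> carrier P; q \<in> carrier P; Q p; Q q\<rbrakk> \<Longrightarrow> Q (p \<oplus>\<^bsub>P\<^esub> q)"
    and mult: "\<And>p q. \<lbrakk>p \<in> carrier P; q \<in> carrier P; Q p; Q q\<rbrakk> \<Longrightarrow> Q (p \<otimes>\<^bsub>P\<^esub> q)"
  shows "Q p"
proof -
  have monom: "Q (up_ring.monom P c n)" if c: "c \<in> carrier R" for c n
  proof (induction n)
    case 0
    then show ?case using const c by simp
  next
    case (Suc n)
    have "up_ring.monom P c (Suc n) = up_ring.monom P c n \<otimes>\<^bsub>P\<^esub> up_ring.monom P \<one> 1"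
      using monom_mult[OF c R.one_closed, of n 1] c by simp
    then show ?case using mult[OF _ _ Suc var] c by simp
  qed
  have "Q (finsum P (\<lambda>k. up_ring.monom P (up_ring.coeff P p k) k) {..n})" for n
  proof (induction n)
    case 0
    then show ?case using monom p by simp
  next
    case (Suc n)
    then show ?case using add monom p by (simp add: Pi_def)
  qed
  then show ?thesis using up_repr[OF p] by metis
qed

lemma (in cring) polyUV_induct [consumes 1, case_names const varU varV add mult]:
  assumes "p \<in> carrier (polyUV R)"
    and const: "\<And>c. c \<in> carrier R \<Longrightarrow> Q (constUV R c)"
    and varU: "Q (varU R)" and varV: "Q (varV R)"
    and add: "\<And>p q. \<lbrakk>p \<in> carrier (polyUV R); q \<in> carrier (polyUV R); Q p; Q q\<rbrakk>
      \<Longrightarrow> Q (p \<oplus>\<^bsub>polyUV R\<^esub> q)"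
    and mult: "\<And>p q. \<lbrakk>p \<in> carrier (polyUV R); q \<in> carrier (polyUV R); Q p; Q q\<rbrakk>
      \<Longrightarrow> Q (p \<otimes>\<^bsub>polyUV R\<^esub> q)"
  shows "Q p"
proof -
  interpret P: UP_cring R "UP R" by unfold_locales
  interpret PP: UP_cring "UP R" "polyUV R" by unfold_locales (simp add: polyUV_def)
  \<comment> \<open>The constants of the outer ring are the polynomials in \<open>U\<close>, so the
    inner induction supplies the constant case of the outer one.\<close>
  have "Q (up_ring.monom (polyUV R) q 0)" if "q \<in> carrier (UP R)" for q
    using that
  proof (induction rule: P.UP_subring_induct)
    case (const c)
    then show ?case using assms(2) by (simp add: constUV_def)
  next
    case var
    then show ?case using varU by (simp add: varU_def)
  next
    case (add p q)
    then show ?case using assms(5)[of "up_ring.monom (polyUV R) p 0" "up_ring.monom (polyUV R) q 0"]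
      by simp
  next
    case (mult p q)
    then show ?case using assms(6)[of "up_ring.monom (polyUV R) p 0" "up_ring.monom (polyUV R) q 0"]
      PP.monom_mult[of p q 0 0] by simp
  qed
  with assms(1) show ?thesis
    by (induction rule: PP.UP_subring_induct) (use varV add mult in \<open>auto simp: varV_def\<close>)
qed

context cring
begin

lemma polyUV_cring: "cring (polyUV R)"
proof -
  interpret P: UP_cring R "UP R" by unfold_locales
  interpret PP: UP_cring "UP R" "polyUV R" by unfold_locales (simp add: polyUV_def)
  show ?thesis by (rule PP.P.cring_axioms)
qed

lemma constUV_hom: "constUV R \<in> ring_hom R (polyUV R)"
proof -
  interpret P: UP_cring R "UP R" by unfold_locales
  interpret PP: UP_cring "UP R" "polyUV R" by unfold_locales (simp add: polyUV_def)
  show ?thesis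
    using ring_hom_trans[OF P.const_ring_hom PP.const_ring_hom]
    by (simp add: constUV_def[abs_def] comp_def)
qed

lemma varUV_closed: "varU R \<in> carrier (polyUV R)" "varV R \<in> carrier (polyUV R)"
proof -
  interpret P: UP_cring R "UP R" by unfold_locales
  interpret PP: UP_cring "UP R" "polyUV R" by unfold_locales (simp add: polyUV_def)
  show "varU R \<in> carrier (polyUV R)" "varV R \<in> carrier (polyUV R)"
    by (simp_all add: varU_def varV_def)
qed

definition unimod_poly :: "'a \<Rightarrow> 'a \<Rightarrow> nat \<Rightarrow> nat \<Rightarrow> 'a" where
  "unimod_poly a b = (constUV R a \<otimes>\<^bsub>polyUV R\<^esub> varU R) \<ominus>\<^bsub>polyUV R\<^esub>
     (constUV R b \<otimes>\<^bsub>polyUV R\<^esub> varV R) \<ominus>\<^bsub>polyUV R\<^esub> \<one>\<^bsub>polyUV R\<^esub>"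

lemma unimod_poly_closed:
  assumes "a \<in> carrier R" "b \<in> carrier R"
  shows "unimod_poly a b \<in> carrier (polyUV R)"
proof -
  interpret Q: cring "polyUV R" by (rule polyUV_cring)
  show ?thesis
    using assms varUV_closed ring_hom_closed[OF constUV_hom] by (simp add: unimod_poly_def)
qed

text \<open>The principal form presents each member of the ideal as an explicit multiple of one
  polynomial, as the degree argument for \<open>canA_inj\<close> requires.\<close>

lemma rel_ideal_eq:
  assumes "a \<in> carrier R" "b \<in> carrier R"
  shows "rel_ideal R a b = PIdl\<^bsub>polyUV R\<^esub> (unimod_poly a b)"
proof -
  interpret Q: cring "polyUV R" by (rule polyUV_cring)
  show ?thesis
    using Q.cgenideal_eq_genideal[OF unimod_poly_closed[OF assms]]
    by (simp add: rel_ideal_def unimod_poly_def)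
qed

lemma rel_ideal_ideal:
  assumes "a \<in> carrier R" "b \<in> carrier R"
  shows "ideal (rel_ideal R a b) (polyUV R)"
proof -
  interpret Q: cring "polyUV R" by (rule polyUV_cring)
  show ?thesis
    using Q.cgenideal_ideal unimod_poly_closed assms by (simp add: rel_ideal_eq)
qed

lemma canA_hom:
  assumes "a \<in> carrier R" "b \<in> carrier R"
  shows "canA R a b \<in> ring_hom R (Aab R a b)"
  using ring_hom_trans[OF constUV_hom ideal.rcos_ring_hom[OF rel_ideal_ideal[OF assms]]]
  by (simp add: canA_def[abs_def] comp_def Aab_def)

end

text \<open>Degrees in \<open>V\<close> decide this. As \<open>b\<close> is nonzero, the defining
  polynomial has degree at least 1, and over a domain so has each of its nonzero multiples. A
  nonzero constant has degree 0 and hence lies outside the ideal.\<close>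

lemma (in domain) canA_inj:
  assumes ab: "a \<in> carrier R" "b \<in> carrier R" and b: "b \<noteq> \<zero>"
  shows "inj_on (canA R a b) (carrier R)"
proof -
  interpret P: UP_domain R "UP R" by unfold_locales
  interpret PP: UP_domain "UP R" "polyUV R" by unfold_locales (simp add: polyUV_def)
  interpret I: ideal "rel_ideal R a b" "polyUV R" by (rule rel_ideal_ideal[OF ab])
  interpret K: ring_hom_ring R "Aab R a b" "canA R a b"
    unfolding Aab_def
    by (rule ring_hom_ringI2[OF ring_axioms I.quotient_is_ring])
      (use canA_hom[OF ab] in \<open>simp add: Aab_def\<close>)
  let ?h = "unimod_poly a b"
  have hc: "?h \<in> carrier (polyUV R)" by (rule unimod_poly_closed[OF ab])
  \<comment> \<open>Only the term \<open>-bV\<close> contributes to the coefficient of the first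
    power of \<open>V\<close>.\<close>
  have co: "up_ring.coeff (polyUV R) ?h 1 = \<ominus>\<^bsub>UP R\<^esub> up_ring.monom (UP R) b 0"
  proof -
    have e: "constUV R a \<otimes>\<^bsub>polyUV R\<^esub> varU R =
        up_ring.monom (polyUV R) (up_ring.monom (UP R) a 0 \<otimes>\<^bsub>UP R\<^esub> up_ring.monom (UP R) \<one> 1) 0"
      "constUV R b \<otimes>\<^bsub>polyUV R\<^esub> varV R = up_ring.monom (polyUV R) (up_ring.monom (UP R) b 0) 1"
      unfolding constUV_def varU_def varV_def using ab
      using PP.monom_mult[of "up_ring.monom (UP R) a 0" "up_ring.monom (UP R) \<one> 1" 0 0]
      using PP.monom_mult[of "up_ring.monom (UP R) b 0" "\<one>\<^bsub>UP R\<^esub>" 0 1]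
      by simp_all
    show ?thesis
      unfolding unimod_poly_def e a_minus_def using ab
      by (simp del: PP.monom_mult)
  qed
  have nz: "up_ring.coeff (polyUV R) ?h 1 \<noteq> \<zero>\<^bsub>UP R\<^esub>"
  proof
    assume "up_ring.coeff (polyUV R) ?h 1 = \<zero>\<^bsub>UP R\<^esub>"
    then have "up_ring.monom (UP R) b 0 = up_ring.monom (UP R) \<zero> 0"
      using co ab P.P.add.inv_eq_1_iff[of "up_ring.monom (UP R) b 0"] by (simp add: a_inv_def)
    then show False using inj_onD[OF P.monom_inj[of 0], of b \<zero>] ab b by simp
  qed
  then have deg: "1 \<le> deg (UP R) ?h"
    using hc by (rule PP.deg_belowI)
  have hnz: "?h \<noteq> \<zero>\<^bsub>polyUV R\<^esub>" using nz by auto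
  have "x = \<zero>" if x: "x \<in> carrier R" "canA R a b x = \<zero>\<^bsub>Aab R a b\<^esub>" for x
  proof (rule ccontr)
    assume xnz: "x \<noteq> \<zero>"
    have "constUV R x \<in> rel_ideal R a b"
      using x I.rcos_const_imp_mem ring_hom_closed[OF constUV_hom x(1)] by (simp add: canA_def Aab_def FactRing_def)
    then obtain q where q: "q \<in> carrier (polyUV R)" "constUV R x = q \<otimes>\<^bsub>polyUV R\<^esub> ?h"
      unfolding rel_ideal_eq[OF ab] cgenideal_def by blast
    have "constUV R x \<noteq> \<zero>\<^bsub>polyUV R\<^esub>"
    proof
      assume "constUV R x = \<zero>\<^bsub>polyUV R\<^esub>"
      then have "up_ring.monom (polyUV R) (up_ring.monom (UP R) x 0) 0 = up_ring.monom (polyUV R) (up_ring.monom (UP R) \<zero> 0) 0"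
        by (simp add: constUV_def)
      then have "up_ring.monom (UP R) x 0 = up_ring.monom (UP R) \<zero> 0"
        using inj_onD[OF PP.monom_inj[of 0], of "up_ring.monom (UP R) x 0" "up_ring.monom (UP R) \<zero> 0"] x by simp
      then show False using inj_onD[OF P.monom_inj[of 0], of x \<zero>] x xnz by simp
    qed
    then have "q \<noteq> \<zero>\<^bsub>polyUV R\<^esub>" using q hc by auto
    then have "deg (UP R) (constUV R x) = deg (UP R) q + deg (UP R) ?h"
      using q hc hnz PP.deg_mult by simp
    moreover have "deg (UP R) (constUV R x) = 0"
      using x by (simp add: constUV_def)
    ultimately show False using deg by simp
  qed
  then have "a_kernel R (Aab R a b) (canA R a b) = {\<zero>}"
    unfolding a_kernel_def' using K.hom_zero zero_closed by blast
  then show ?thesis by (rule K.trivial_ker_imp_inj)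
qed

section \<open>Good pairs satisfy the abstract assumptions\<close>

lemma (in cring) height_two_proper:
  assumes ab: "a \<in> carrier R" "b \<in> carrier R" and ht: "ideal_height R (Idl {a, b}) = 2"
  shows "\<one> \<notin> Idl {a, b}"
proof
  interpret I: ideal "Idl {a, b}" R by (rule genideal_ideal) (use ab in auto)
  assume "\<one> \<in> Idl {a, b}"
  then have whole: "Idl {a, b} = carrier R" by (rule I.one_imp_carrier)
  have "\<not> carrier R \<subseteq> P" if "primeideal P R" for P
  proof -
    interpret primeideal P R by fact
    show ?thesis using I_notcarr a_subset by blast
  qed
  then have "{P. primeideal P R \<and> Idl {a, b} \<subseteq> P} = {}" unfolding whole by blast
  \<comment> \<open>With no prime above the unit ideal, the height is an infimum over the empty set,
    which in \<open>enat\<close> is infinity.\<close>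
  then have "ideal_height R (Idl {a, b}) = \<infinity>"
    unfolding ideal_height_def by (simp only: image_empty Inf_empty top_enat_def)
  with ht show False by (metis enat.distinct(1) numeral_eq_enat)
qed

lemma (in domain) good_pair_unimodular_extension:
  assumes gp: "good_pair R iR a b"
  shows "unimodular_extension (Aab R a b) (iAab R iR a b) R (canA R a b) a b
    (rel_ideal R a b +>\<^bsub>polyUV R\<^esub> varU R) (rel_ideal R a b +>\<^bsub>polyUV R\<^esub> varV R)"
    (is "unimodular_extension ?A _ _ ?i _ _ ?U ?V")
proof -
  have ab: "a \<in> carrier R" "b \<in> carrier R"
    and proper: "\<one> \<notin> Idl {a, b}"
    and cop: "\<And>c. c \<in> carrier R \<Longrightarrow> c divides a \<Longrightarrow> c divides b \<Longrightarrow> c \<in> Units R"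
    and fd: "factorial_domain ?A"
    and ml: "makar_limanov ?A (iAab R iR a b) = ?i ` carrier R"
    using gp height_two_proper unfolding good_pair_def by auto
  \<comment> \<open>If \<open>b\<close> were zero, \<open>a\<close> would be a common divisor of
    \<open>a\<close> and \<open>b\<close>, hence a unit, and the ideal would contain 1.\<close>
  have b: "b \<noteq> \<zero>"
  proof
    assume "b = \<zero>"
    then have "a \<in> Units R" using cop[OF ab(1)] divides_refl divides_zero ab(1) by simp
    then have "\<one> = inv a \<otimes> a \<oplus> \<zero> \<otimes> b" "inv a \<in> carrier R" using ab by simp_all
    then have "\<one> \<in> Idl {a, b}" using genideal_pair[OF ab] by blast
    with proper show False ..
  qed
  interpret A: domain ?A using fd by (simp add: factorial_domain_def)
  interpret Q: cring "polyUV R" by (rule polyUV_cring)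
  interpret I: ideal "rel_ideal R a b" "polyUV R" by (rule rel_ideal_ideal[OF ab])
  let ?q = "\<lambda>p. rel_ideal R a b +>\<^bsub>polyUV R\<^esub> p"
  have q: "?q \<in> ring_hom (polyUV R) ?A" unfolding Aab_def by (rule I.rcos_ring_hom)
  note v = varUV_closed and cc = ring_hom_closed[OF constUV_hom]
  have c: "constUV R a \<in> carrier (polyUV R)" "constUV R b \<in> carrier (polyUV R)" using ab cc by auto
  have "?q (unimod_poly a b) = \<zero>\<^bsub>?A\<^esub>"
    using I.a_rcos_const Q.cgenideal_self[OF unimod_poly_closed[OF ab]]
    by (simp add: rel_ideal_eq[OF ab] Aab_def FactRing_def)
  then have "?q (constUV R a \<otimes>\<^bsub>polyUV R\<^esub> varU R) =
    ?q (unimod_poly a b) \<oplus>\<^bsub>?A\<^esub> ?q (constUV R b \<otimes>\<^bsub>polyUV R\<^esub> varV R \<oplus>\<^bsub>polyUV R\<^esub> \<one>\<^bsub>polyUV R\<^esub>)"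
  proof -
    have "constUV R a \<otimes>\<^bsub>polyUV R\<^esub> varU R = unimod_poly a b \<oplus>\<^bsub>polyUV R\<^esub>
      (constUV R b \<otimes>\<^bsub>polyUV R\<^esub> varV R \<oplus>\<^bsub>polyUV R\<^esub> \<one>\<^bsub>polyUV R\<^esub>)"
      unfolding unimod_poly_def using c v Q.one_closed by algebra
    then show ?thesis using ring_hom_add[OF q] unimod_poly_closed[OF ab] c v by simp
  qed
  with \<open>?q (unimod_poly a b) = \<zero>\<^bsub>?A\<^esub>\<close>
  have unimod: "?i a \<otimes>\<^bsub>?A\<^esub> ?U = ?i b \<otimes>\<^bsub>?A\<^esub> ?V \<oplus>\<^bsub>?A\<^esub> \<one>\<^bsub>?A\<^esub>"
    using c v by (simp add: ring_hom_add[OF q] ring_hom_mult[OF q] ring_hom_one[OF q]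
        ring_hom_closed[OF q] canA_def)
  show ?thesis
  proof (unfold_locales)
    show "?i \<in> ring_hom R ?A" by (rule canA_hom[OF ab])
    show "inj_on ?i (carrier R)" by (rule canA_inj[OF ab b])
    show "?U \<in> carrier ?A" "?V \<in> carrier ?A" using ring_hom_closed[OF q] v by auto
  next
    fix S x
    assume S: "?i ` carrier R \<subseteq> S" "?U \<in> S" "?V \<in> S"
        "\<And>x y. \<lbrakk>x \<in> carrier ?A; y \<in> carrier ?A; x \<in> S; y \<in> S\<rbrakk> \<Longrightarrow> x \<oplus>\<^bsub>?A\<^esub> y \<in> S"
        "\<And>x y. \<lbrakk>x \<in> carrier ?A; y \<in> carrier ?A; x \<in> S; y \<in> S\<rbrakk> \<Longrightarrow> x \<otimes>\<^bsub>?A\<^esub> y \<in> S"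
      and x: "x \<in> carrier ?A"
    obtain p where p: "p \<in> carrier (polyUV R)" "x = ?q p"
      using x by (auto simp: Aab_def FactRing_def A_RCOSETS_def')
    \<comment> \<open>Induction on a representing polynomial: constants map into the image of
      \<open>R\<close>, the two variables map to the chosen generators, and the quotient map
      respects sums and products.\<close>
    from p(1) have "?q p \<in> S"
      by (induction rule: polyUV_induct)
        (use S ring_hom_closed[OF q] in
          \<open>auto simp: canA_def ring_hom_add[OF q] ring_hom_mult[OF q]\<close>)
    then show "x \<in> S" using p by simp
  qed (use ab unimod ml in auto)
qed

section \<open>Comparison of the two ideals through an isomorphism\<close>

theorem mainTheorem7:
  fixes R :: "'a ring" and iR :: "complex \<Rightarrow> 'a" and r s r' s' :: 'a
  assumes "is_C_algebra R iR"
    and "noetherian_domain R"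
    and "factorial_domain R"
    and "good_pair R iR r s"
    and "good_pair R iR r' s'"
    and "\<exists>f. C_alg_iso (Aab R r s) (iAab R iR r s) (Aab R r' s') (iAab R iR r' s') f"
  shows "\<exists>\<phi>\<in>C_alg_aut R iR. Idl\<^bsub>R\<^esub> {\<phi> r, \<phi> s} = Idl\<^bsub>R\<^esub> {r', s'}"
proof -
  interpret R: domain R using assms(3) by (simp add: factorial_domain_def)
  let ?A = "Aab R r s" and ?B = "Aab R r' s'"
  let ?iA = "iAab R iR r s" and ?iB = "iAab R iR r' s'"
  let ?j = "canA R r s" and ?k = "canA R r' s'"
  interpret A: unimodular_extension ?A ?iA R ?j r s
    "rel_ideal R r s +>\<^bsub>polyUV R\<^esub> varU R" "rel_ideal R r s +>\<^bsub>polyUV R\<^esub> varV R"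
    by (rule R.good_pair_unimodular_extension[OF assms(4)])
  interpret B: unimodular_extension ?B ?iB R ?k r' s'
    "rel_ideal R r' s' +>\<^bsub>polyUV R\<^esub> varU R" "rel_ideal R r' s' +>\<^bsub>polyUV R\<^esub> varV R"
    by (rule R.good_pair_unimodular_extension[OF assms(5)])
  have iR: "iR c \<in> carrier R" for c
    using assms(1) by (auto simp: is_C_algebra_def CC_def ring_hom_def)
  have iA: "?iA c \<in> carrier ?A" and iB: "?iB c \<in> carrier ?B" for c using iR by (auto simp: iAab_def)
  obtain f where f: "C_alg_iso ?A ?iA ?B ?iB f" using assms(6) by blast
  define h where "h = inv_into (carrier ?A) f"
  have h: "C_alg_iso ?B ?iB ?A ?iA h"
    unfolding h_def by (rule C_alg_iso_sym[OF f A.cring_axioms B.cring_axioms iA])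
  have fr: "f \<in> ring_hom ?A ?B" "\<And>c. f (?iA c) = ?iB c" and hr: "h \<in> ring_hom ?B ?A"
    and bij: "bij_betw f (carrier ?A) (carrier ?B)"
    using f h by (auto simp: C_alg_iso_def C_alg_hom_def)
  have fh [simp]: "\<And>y. y \<in> carrier ?B \<Longrightarrow> f (h y) = y"
    and hf [simp]: "\<And>x. x \<in> carrier ?A \<Longrightarrow> h (f x) = x"
    unfolding h_def using bij by (auto simp: bij_betw_inv_into_right bij_betw_inv_into_left)
  note [simp] = ring_hom_closed[OF fr(1)] ring_hom_closed[OF hr]

  \<comment> \<open>Both copies of \<open>R\<close> are Makar-Limanov invariants. Hence
    \<open>f\<close> maps the first into the second, and \<open>h\<close> maps back, so every
    element of the second copy is reached.\<close>
  have ex1: "\<exists>y\<in>carrier R. f (?j x) = ?k y" if "x \<in> carrier R" for x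
    using makar_limanov_iso[OF f A.cring_axioms B.cring_axioms iA, of "?j x"] that
    unfolding A.ml_base B.ml_base by blast
  have ex2: "\<exists>x\<in>carrier R. f (?j x) = ?k y" if y: "y \<in> carrier R" for y
  proof -
    have "h (?k y) \<in> ?j ` carrier R"
      using makar_limanov_iso[OF h B.cring_axioms A.cring_axioms iB, of "?k y"] y
      unfolding A.ml_base B.ml_base by blast
    then obtain x where "x \<in> carrier R" "h (?k y) = ?j x" by blast
    then show ?thesis using y by (metis B.i_closed fh)
  qed
  \<comment> \<open>This is \<open>f\<close> restricted to the copies of \<open>R\<close> and read
    through the two embeddings. Injectivity of the second embedding characterises its values by
    \<open>phi_eqI\<close>, from which all its properties follow.\<close>
  define \<phi> where "\<phi> x = inv_into (carrier R) ?k (f (?j x))" for x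
  have phi_eqI: "\<phi> x = y" if "y \<in> carrier R" "f (?j x) = ?k y" for x y
    unfolding \<phi>_def that(2) by (rule inv_into_f_f[OF B.inj that(1)])
  have phi: "\<phi> x \<in> carrier R" "?k (\<phi> x) = f (?j x)" if "x \<in> carrier R" for x
    using ex1[OF that] phi_eqI by metis+
  have phi_hom: "\<phi> \<in> ring_hom R R"
  proof (rule ring_hom_memI)
    show "\<phi> (x \<otimes>\<^bsub>R\<^esub> y) = \<phi> x \<otimes>\<^bsub>R\<^esub> \<phi> y" if "x \<in> carrier R" "y \<in> carrier R" for x y
      by (rule phi_eqI) (use that phi in \<open>auto simp: ring_hom_mult[OF A.hom]
        ring_hom_mult[OF B.hom] ring_hom_mult[OF fr(1)]\<close>)
    show "\<phi> (x \<oplus>\<^bsub>R\<^esub> y) = \<phi> x \<oplus>\<^bsub>R\<^esub> \<phi> y" if "x \<in> carrier R" "y \<in> carrier R" for x y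
      by (rule phi_eqI) (use that phi in \<open>auto simp: ring_hom_add[OF A.hom]
        ring_hom_add[OF B.hom] ring_hom_add[OF fr(1)]\<close>)
    show "\<phi> \<one>\<^bsub>R\<^esub> = \<one>\<^bsub>R\<^esub>"
      by (rule phi_eqI) (auto simp: ring_hom_one[OF A.hom] ring_hom_one[OF B.hom] ring_hom_one[OF fr(1)])
  qed (use phi in auto)
  have phi_C: "\<phi> (iR c) = iR c" for c
    by (rule phi_eqI) (use iR fr(2) in \<open>auto simp: iAab_def\<close>)
  have phi_bij: "bij_betw \<phi> (carrier R) (carrier R)"
    unfolding bij_betw_def
  proof
    show "inj_on \<phi> (carrier R)"
    proof (rule inj_onI)
      fix x y assume xy: "x \<in> carrier R" "y \<in> carrier R" "\<phi> x = \<phi> y"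
      then have "f (?j x) = f (?j y)" using phi by metis
      then have "?j x = ?j y" using xy by (metis A.i_closed hf)
      then show "x = y" using A.inj xy by (auto dest: inj_onD)
    qed
    show "\<phi> ` carrier R = carrier R"
      using phi(1) ex2 phi_eqI by (fastforce simp: image_iff)
  qed

  have rs: "r \<in> carrier R" "s \<in> carrier R" "r' \<in> carrier R" "s' \<in> carrier R"
    using A.ab B.ab by auto
  have "\<one>\<^bsub>R\<^esub> \<notin> Idl\<^bsub>R\<^esub> {r, s}"
    using R.height_two_proper[OF rs(1,2)] assms(4) by (simp add: good_pair_def)
  then obtain E where E: "E \<in> LND ?A ?iA" "A.wronskian E \<noteq> \<zero>\<^bsub>?A\<^esub>"
    using A.ex_LND_wronskian_nonzero by blast
  define F where "F = (\<lambda>y. f (E (h y)))"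
  have F: "F \<in> LND ?B ?iB"
    unfolding F_def by (rule LND_conjugate[OF f h fh hf A.cring_axioms B.cring_axioms iA E(1)])
  define g where "g = A.wronskian E"
  define g' where "g' = B.wronskian F"
  have gc: "g \<in> carrier ?A" "g' \<in> carrier ?B" using E F by (simp_all add: g_def g'_def)
  have minus: "f (x \<ominus>\<^bsub>?A\<^esub> y) = f x \<ominus>\<^bsub>?B\<^esub> f y" if "x \<in> carrier ?A" "y \<in> carrier ?A" for x y
    using that ring_hom_add[OF fr(1)]
      ring_hom_cring.hom_a_inv[OF ring_hom_cringI[OF A.cring_axioms B.cring_axioms fr(1)]]
    by (simp add: a_minus_def)
  have Ff: "F (f x) = f (E x)" if "x \<in> carrier ?A" for x using that by (simp add: F_def)
  \<comment> \<open>Applying \<open>f\<close> to the formula for \<open>g\<close> writes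
    \<open>f g\<close> through the values of \<open>F\<close> at the images of the generators of the
    first algebra; all values of \<open>F\<close> are multiples of \<open>g'\<close>.\<close>
  have "\<exists>l\<in>carrier ?B. f g = g' \<otimes>\<^bsub>?B\<^esub> l"
  proof -
    let ?U = "rel_ideal R r s +>\<^bsub>polyUV R\<^esub> varU R" and ?V = "rel_ideal R r s +>\<^bsub>polyUV R\<^esub> varV R"
    have c: "f ?U \<in> carrier ?B" "f ?V \<in> carrier ?B" using A.UV by auto
    obtain k where k: "k \<in> carrier ?B" "F (f ?U) = g' \<otimes>\<^bsub>?B\<^esub> k"
      using B.wronskian_dvd[OF F c(1)] unfolding g'_def ..
    obtain l where l: "l \<in> carrier ?B" "F (f ?V) = g' \<otimes>\<^bsub>?B\<^esub> l"
      using B.wronskian_dvd[OF F c(2)] unfolding g'_def ..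
    note kl = k(1) l(1) k(2) l(2)
    have "f g = f ?U \<otimes>\<^bsub>?B\<^esub> F (f ?V) \<ominus>\<^bsub>?B\<^esub> f ?V \<otimes>\<^bsub>?B\<^esub> F (f ?U)"
      using A.UV E(1) unfolding g_def A.wronskian_def by (simp add: minus Ff ring_hom_mult[OF fr(1)])
    also have "\<dots> = g' \<otimes>\<^bsub>?B\<^esub> (f ?U \<otimes>\<^bsub>?B\<^esub> l \<ominus>\<^bsub>?B\<^esub> f ?V \<otimes>\<^bsub>?B\<^esub> k)"
      unfolding kl using kl(1,2) c gc by algebra
    finally show ?thesis using kl c by blast
  qed
  then obtain l where l: "l \<in> carrier ?B" "f g = g' \<otimes>\<^bsub>?B\<^esub> l" by blast
  \<comment> \<open>Conversely, every value of \<open>F\<close> is the image of a value of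
    \<open>E\<close>, hence a multiple of \<open>f g\<close>. Now \<open>?U\<close> and
    \<open>?V\<close> are the generators of the second algebra, whose Wronskian is
    \<open>g'\<close>.\<close>
  have "\<exists>m\<in>carrier ?B. g' = f g \<otimes>\<^bsub>?B\<^esub> m"
  proof -
    let ?U = "rel_ideal R r' s' +>\<^bsub>polyUV R\<^esub> varU R" and ?V = "rel_ideal R r' s' +>\<^bsub>polyUV R\<^esub> varV R"
    have dvd: "\<exists>k\<in>carrier ?B. F y = f g \<otimes>\<^bsub>?B\<^esub> k" if "y \<in> carrier ?B" for y
    proof -
      obtain k where "k \<in> carrier ?A" "E (h y) = g \<otimes>\<^bsub>?A\<^esub> k"
        using A.wronskian_dvd[OF E(1) ring_hom_closed[OF hr \<open>y \<in> carrier ?B\<close>]] unfolding g_def ..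
      then show ?thesis using gc by (auto simp: F_def ring_hom_mult[OF fr(1)])
    qed
    obtain k where k: "k \<in> carrier ?B" "F ?U = f g \<otimes>\<^bsub>?B\<^esub> k" using dvd[OF B.UV(1)] ..
    obtain m where m: "m \<in> carrier ?B" "F ?V = f g \<otimes>\<^bsub>?B\<^esub> m" using dvd[OF B.UV(2)] ..
    note kl = k(1) m(1) k(2) m(2)
    have fg: "f g \<in> carrier ?B" using gc by simp
    have "g' = f g \<otimes>\<^bsub>?B\<^esub> (?U \<otimes>\<^bsub>?B\<^esub> m \<ominus>\<^bsub>?B\<^esub> ?V \<otimes>\<^bsub>?B\<^esub> k)"
      unfolding g'_def B.wronskian_def kl using kl(1,2) B.UV fg by algebra
    then show ?thesis using kl B.UV by blast
  qed
  then obtain m where m: "m \<in> carrier ?B" "g' = f g \<otimes>\<^bsub>?B\<^esub> m" by blast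
  have g'_nz: "g' \<noteq> \<zero>\<^bsub>?B\<^esub>"
  proof
    assume "g' = \<zero>\<^bsub>?B\<^esub>"
    then have "f g = f \<zero>\<^bsub>?A\<^esub>"
      using l ring_hom_zero[OF fr(1) A.ring_axioms B.ring_axioms] by simp
    then have "g = \<zero>\<^bsub>?A\<^esub>" using gc by (metis A.zero_closed hf)
    with E(2) show False by (simp add: g_def)
  qed
  \<comment> \<open>The two divisibilities combine to \<open>g' l m = g'\<close>. Cancelling the
    nonzero \<open>g'\<close> makes \<open>l\<close> a unit, and the hypothesis on units of the
    quotient brings it down to a unit \<open>u\<close> of \<open>R\<close>.\<close>
  have "g' \<otimes>\<^bsub>?B\<^esub> (l \<otimes>\<^bsub>?B\<^esub> m) = g' \<otimes>\<^bsub>?B\<^esub> \<one>\<^bsub>?B\<^esub>"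
    using l(1) m(1) gc(2)
    by (simp add: B.m_assoc[symmetric] l(2)[symmetric] m(2)[symmetric])
  then have "l \<otimes>\<^bsub>?B\<^esub> m = \<one>\<^bsub>?B\<^esub>"
    using B.m_lcancel[OF g'_nz gc(2)] l(1) m(1) by simp
  then have "l \<in> Units ?B" using l(1) m(1) B.m_comm[of l m] unfolding Units_def by auto
  then obtain u where u: "u \<in> Units R" "l = ?k u"
    using assms(5) unfolding good_pair_def by auto
  have uc: "u \<in> carrier R" using u by blast
  interpret I: ideal "Idl\<^bsub>R\<^esub> {r', s'}" R by (rule R.genideal_ideal) (use rs in auto)
  \<comment> \<open>Membership becomes solvability of \<open>E x = g c\<close>, is carried by
    \<open>f\<close> to solvability of \<open>F y = g' u \<phi>(c)\<close>, and is translated back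
    by the same criterion in the second algebra. The unit \<open>u\<close> does not affect
    membership in an ideal.\<close>
  have key: "c \<in> Idl\<^bsub>R\<^esub> {r, s} \<longleftrightarrow> \<phi> c \<in> Idl\<^bsub>R\<^esub> {r', s'}" if c: "c \<in> carrier R" for c
  proof -
    have "c \<in> Idl\<^bsub>R\<^esub> {r, s} \<longleftrightarrow> (\<exists>x\<in>carrier ?A. E x = g \<otimes>\<^bsub>?A\<^esub> ?j c)"
      unfolding g_def by (rule A.mem_ideal_iff_LND[OF E c])
    also have "\<dots> \<longleftrightarrow> (\<exists>x\<in>carrier ?A. F (f x) = f (g \<otimes>\<^bsub>?A\<^esub> ?j c))"
    proof -
      have "E x = g \<otimes>\<^bsub>?A\<^esub> ?j c \<longleftrightarrow> F (f x) = f (g \<otimes>\<^bsub>?A\<^esub> ?j c)" if x: "x \<in> carrier ?A" for x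
        unfolding Ff[OF x]
        using inj_on_eq_iff[OF bij_betw_imp_inj_on[OF bij], of "E x" "g \<otimes>\<^bsub>?A\<^esub> ?j c"] E(1) x gc(1) c
        by simp
      then show ?thesis by blast
    qed
    also have "\<dots> \<longleftrightarrow> (\<exists>y\<in>carrier ?B. F y = f (g \<otimes>\<^bsub>?A\<^esub> ?j c))"
      unfolding bij_betw_imp_surj_on[OF bij, symmetric] by blast
    also have "f (g \<otimes>\<^bsub>?A\<^esub> ?j c) = g' \<otimes>\<^bsub>?B\<^esub> ?k (u \<otimes>\<^bsub>R\<^esub> \<phi> c)"
      using gc c phi[OF c] l(1) uc unfolding u(2)
      by (simp add: ring_hom_mult[OF fr(1)] ring_hom_mult[OF B.hom] B.m_assoc l(2) u(2))
    also have "(\<exists>y\<in>carrier ?B. F y = g' \<otimes>\<^bsub>?B\<^esub> ?k (u \<otimes>\<^bsub>R\<^esub> \<phi> c))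
      \<longleftrightarrow> u \<otimes>\<^bsub>R\<^esub> \<phi> c \<in> Idl\<^bsub>R\<^esub> {r', s'}"
      unfolding g'_def
      by (rule B.mem_ideal_iff_LND[OF F, symmetric]) (use g'_nz uc phi[OF c] in \<open>auto simp: g'_def\<close>)
    also have "\<dots> \<longleftrightarrow> \<phi> c \<in> Idl\<^bsub>R\<^esub> {r', s'}"
    proof
      assume "u \<otimes>\<^bsub>R\<^esub> \<phi> c \<in> Idl\<^bsub>R\<^esub> {r', s'}"
      then have "inv\<^bsub>R\<^esub> u \<otimes>\<^bsub>R\<^esub> (u \<otimes>\<^bsub>R\<^esub> \<phi> c) \<in> Idl\<^bsub>R\<^esub> {r', s'}"
        by (rule I.I_l_closed) (rule R.Units_inv_closed[OF u(1)])
      then show "\<phi> c \<in> Idl\<^bsub>R\<^esub> {r', s'}"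
        using u(1) uc phi(1)[OF c] by (simp add: R.m_assoc[symmetric])
    qed (rule I.I_l_closed[OF _ uc])
    finally show ?thesis .
  qed
  have prs: "\<phi> r \<in> carrier R" "\<phi> s \<in> carrier R" using phi rs by auto
  have "Idl\<^bsub>R\<^esub> {\<phi> r, \<phi> s} = Idl\<^bsub>R\<^esub> {r', s'}"
  proof
    have "r \<in> Idl\<^bsub>R\<^esub> {r, s}" "s \<in> Idl\<^bsub>R\<^esub> {r, s}" using R.genideal_self[of "{r, s}"] rs by auto
    then show "Idl\<^bsub>R\<^esub> {\<phi> r, \<phi> s} \<subseteq> Idl\<^bsub>R\<^esub> {r', s'}"
      using key rs by (intro R.genideal_minimal I.ideal_axioms) auto
    \<comment> \<open>Surjectivity of \<open>\<phi>\<close> gives a preimage \<open>c\<close>, which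
      \<open>key\<close> places in the ideal of \<open>r\<close> and \<open>s\<close>. Applying
      \<open>\<phi>\<close> to a linear combination representing \<open>c\<close> represents
      \<open>d\<close>.\<close>
    show "Idl\<^bsub>R\<^esub> {r', s'} \<subseteq> Idl\<^bsub>R\<^esub> {\<phi> r, \<phi> s}"
    proof
      fix d assume d: "d \<in> Idl\<^bsub>R\<^esub> {r', s'}"
      then obtain c where c: "c \<in> carrier R" "d = \<phi> c"
        using phi_bij I.Icarr by (metis bij_betw_def imageE)
      then have "c \<in> Idl\<^bsub>R\<^esub> {r, s}" using d key by simp
      then obtain x y where "x \<in> carrier R" "y \<in> carrier R" "c = x \<otimes>\<^bsub>R\<^esub> r \<oplus>\<^bsub>R\<^esub> y \<otimes>\<^bsub>R\<^esub> s"
        using R.genideal_pair[OF rs(1,2)] by auto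
      then have "d = \<phi> x \<otimes>\<^bsub>R\<^esub> \<phi> r \<oplus>\<^bsub>R\<^esub> \<phi> y \<otimes>\<^bsub>R\<^esub> \<phi> s" "\<phi> x \<in> carrier R" "\<phi> y \<in> carrier R"
        using c rs phi by (auto simp: ring_hom_add[OF phi_hom] ring_hom_mult[OF phi_hom])
      then show "d \<in> Idl\<^bsub>R\<^esub> {\<phi> r, \<phi> s}" using R.genideal_pair[OF prs] by blast
    qed
  qed
  moreover have "\<phi> \<in> C_alg_aut R iR"
    using phi_hom phi_C phi_bij by (simp add: C_alg_aut_def C_alg_iso_def C_alg_hom_def)
  ultimately show ?thesis by blast
qed

end
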